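(* For every unistochastic $d\times d$ matrix $T$, the restricted distinguishability number satisfies $\tilde{\mathcal{M}}(T)=d$.
   Context: Fix an orthonormal basis $\{|k\rangle\}_{k=1}^d$ of $\mathbb{C}^d$. A quantum channel is a completely positive trace-preserving linear map $\Phi$ on $d\times d$ complex matrices. Its classical action is the (column-)stochastic matrix $T$ with $T_{kl}=\langle k|\Phi(|l\rangle\langle l|)|k\rangle$. A set of channels $\{\Phi^{(n)}\}_{n=1}^M$ is perfectly distinguishable without using entangled input states if there is a pure state $|\psi\rangle\in\mathbb{C}^d$ such that the output states $\Phi^{(n)}(|\psi\rangle\langle\psi|)$, $n=1,\dots,M$, have pairwise orthogonal supports. The restricted distinguishability number $\tilde{\mathcal{M}}(T)$ is the maximal number of quantum channels that all have classical action $T$ and that are perfectly distinguishable without using entangled input states. A stochastic matrix $T$ is unistochastic if there is a unitary matrix $U$ with $T_{kl}=|U_{kl}|^2$ for all $k,l$. *)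

theory Defs
  imports "HOL-Analysis.Analysis" "HOL-Library.Extended_Nat"
begin

text \<open>
  A \<open>d \<times> d\<close> complex matrix is an element of \<^typ>\<open>complex^'d^'d\<close>, with \<open>d = CARD('d)\<close>;
  \<open>A $ k $ l\<close> is the entry in row \<open>k\<close> and column \<open>l\<close>.
\<close>

definition braket :: "complex^'d \<Rightarrow> complex^'d \<Rightarrow> complex" where
  "braket x y = (\<Sum>i\<in>UNIV. cnj (x $ i) * y $ i)"

definition projector :: "complex^'d \<Rightarrow> complex^'d^'d" where
  "projector x = (\<chi> i j. x $ i * cnj (x $ j))"

definition dagger :: "complex^'d^'d \<Rightarrow> complex^'d^'d" where
  "dagger A = (\<chi> i j. cnj (A $ j $ i))"

definition unitary :: "complex^'d^'d \<Rightarrow> bool" where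
  "unitary U \<longleftrightarrow> dagger U ** U = mat 1 \<and> U ** dagger U = mat 1"

definition orthonormal_basis :: "('d \<Rightarrow> complex^'d) \<Rightarrow> bool" where
  "orthonormal_basis b \<longleftrightarrow>
     (\<forall>k l. braket (b k) (b l) = (if k = l then 1 else 0)) \<and> vec.span (range b) = UNIV"

text \<open>
  The library's \<open>*s\<close> on \<^typ>\<open>complex^'d^'d\<close> takes scalars in \<^typ>\<open>complex^'d\<close>,
  so complex scaling of matrices needs its own constant.
\<close>

definition matrix_scale :: "complex \<Rightarrow> complex^'d^'d \<Rightarrow> complex^'d^'d" where
  "matrix_scale c A = (\<chi> i j. c * A $ i $ j)"

lemma vector_space_matrix_scale: "vector_space matrix_scale"
  by unfold_locales (simp_all add: matrix_scale_def vec_eq_iff algebra_simps)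

text \<open>
  A family \<open>X i j\<close> (\<open>i, j < k\<close>) of \<open>d \<times> d\<close> matrices encodes the element
  \<open>\<Sum>i j. |i\<rangle>\<langle>j| \<otimes> X i j\<close> of the algebra of \<open>k \<times> k\<close> matrices tensored with that of
  \<open>d \<times> d\<close> matrices, and the vectors \<open>v i\<close> encode \<open>\<Sum>i. |i\<rangle> \<otimes> v i\<close>. In this encoding
  \<open>id \<otimes> \<Phi>\<close> applies \<open>\<Phi>\<close> to every block.
\<close>

definition block_positive :: "nat \<Rightarrow> (nat \<Rightarrow> nat \<Rightarrow> complex^'d^'d) \<Rightarrow> bool" where
  "block_positive k X \<longleftrightarrow>
     (\<forall>v. (\<Sum>i<k. \<Sum>j<k. braket (v i) (X i j *v v j)) \<in> \<real>\<^sub>\<ge>\<^sub>0)"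

definition completely_positive :: "(complex^'d^'d \<Rightarrow> complex^'d^'d) \<Rightarrow> bool" where
  "completely_positive \<Phi> \<longleftrightarrow>
     (\<forall>k X. block_positive k X \<longrightarrow> block_positive k (\<lambda>i j. \<Phi> (X i j)))"

definition quantum_channel :: "(complex^'d^'d \<Rightarrow> complex^'d^'d) \<Rightarrow> bool" where
  "quantum_channel \<Phi> \<longleftrightarrow>
     Vector_Spaces.linear matrix_scale matrix_scale \<Phi> \<and>
     completely_positive \<Phi> \<and> (\<forall>X. trace (\<Phi> X) = trace X)"

definition stochastic :: "real^'d^'d \<Rightarrow> bool" where
  "stochastic T \<longleftrightarrow> (\<forall>k l. 0 \<le> T $ k $ l) \<and> (\<forall>l. (\<Sum>k\<in>UNIV. T $ k $ l) = 1)"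

definition unistochastic :: "real^'d^'d \<Rightarrow> bool" where
  "unistochastic T \<longleftrightarrow>
     stochastic T \<and> (\<exists>U. unitary U \<and> (\<forall>k l. T $ k $ l = (cmod (U $ k $ l))\<^sup>2))"

definition has_classical_action ::
  "('d \<Rightarrow> complex^'d) \<Rightarrow> (complex^'d^'d \<Rightarrow> complex^'d^'d) \<Rightarrow> real^'d^'d \<Rightarrow> bool" where
  "has_classical_action b \<Phi> T \<longleftrightarrow>
     (\<forall>k l. complex_of_real (T $ k $ l) = braket (b k) (\<Phi> (projector (b l)) *v b k))"

text \<open>The support is the orthogonal complement of the kernel.\<close>

definition support :: "complex^'d^'d \<Rightarrow> (complex^'d) set" where
  "support A = {x. \<forall>y. A *v y = 0 \<longrightarrow> braket y x = 0}"

definition orthogonal_supports :: "complex^'d^'d \<Rightarrow> complex^'d^'d \<Rightarrow> bool" where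
  "orthogonal_supports A B \<longleftrightarrow> (\<forall>x\<in>support A. \<forall>y\<in>support B. braket x y = 0)"

text \<open>The norm on \<^typ>\<open>complex^'d\<close> is the Hilbert space norm.\<close>

definition perfectly_distinguishable_unentangled ::
  "(complex^'d^'d \<Rightarrow> complex^'d^'d) set \<Rightarrow> bool" where
  "perfectly_distinguishable_unentangled S \<longleftrightarrow>
     (\<exists>\<psi>. norm \<psi> = 1 \<and>
        pairwise (\<lambda>\<Phi> \<Psi>. orthogonal_supports (\<Phi> (projector \<psi>)) (\<Psi> (projector \<psi>))) S)"

text \<open>
  The supremum is taken in \<^typ>\<open>enat\<close>, so that it is meaningful without knowing
  that the set of cardinalities is bounded; whenever it is finite, it is a maximum
  (the set contains 0, because of the empty set of channels).
\<close>

definition restricted_distinguishability ::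
  "('d \<Rightarrow> complex^'d) \<Rightarrow> real^'d^'d \<Rightarrow> enat" where
  "restricted_distinguishability b T =
     Sup {enat (card S) | S. finite S \<and>
       (\<forall>\<Phi>\<in>S. quantum_channel \<Phi> \<and> has_classical_action b \<Phi> T) \<and>
       perfectly_distinguishable_unentangled S}"

end

theory Submission imports Defs begin

text \<open>
  Upper bound: the outputs of the channels have trace one, so their supports contain nonzero
  vectors; these are pairwise orthogonal, and there are at most \<open>d\<close> of them.

  Lower bound: let \<open>U\<close> be a unitary realising \<open>T\<close> in the basis \<open>b\<close>. Multiplying the columns of
  \<open>U\<close> by phases does not change the classical action. For the \<open>d\<close> phase patterns given by the
  characters of the cyclic group of order \<open>d\<close>, the uniform superposition of the basis vectors is
  sent to the Fourier basis followed by \<open>U\<close>, that is, to pairwise orthogonal pure states.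
\<close>

section \<open>Inner product and adjoint\<close>

lemma braket_add_right: "braket x (y + z) = braket x y + braket x z"
  by (simp add: braket_def algebra_simps sum.distrib)

lemma braket_diff_right: "braket x (y - z) = braket x y - braket x z"
  by (simp add: braket_def algebra_simps sum_subtractf)

lemma braket_scale_left: "braket (c *s x) y = cnj c * braket x y"
  by (simp add: braket_def sum_distrib_left algebra_simps)

lemma braket_scale_right: "braket x (c *s y) = c * braket x y"
  by (simp add: braket_def sum_distrib_left algebra_simps)

lemma braket_sum_right: "braket x (\<Sum>i\<in>A. f i) = (\<Sum>i\<in>A. braket x (f i))"
  by (induction A rule: infinite_finite_induct)
    (simp_all add: braket_add_right, simp_all add: braket_def)

lemma cnj_braket: "cnj (braket x y) = braket y x"
  by (simp add: braket_def mult.commute)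

lemma braket_self: "braket x x = complex_of_real ((norm x)\<^sup>2)"
proof -
  have "braket x x = (\<Sum>i\<in>UNIV. complex_of_real ((cmod (x $ i))\<^sup>2))"
    unfolding braket_def
    by (intro sum.cong refl) (metis complex_norm_square mult.commute of_real_power)
  also have "\<dots> = complex_of_real ((norm x)\<^sup>2)"
    by (simp add: norm_vec_def L2_set_def sum_nonneg)
  finally show ?thesis .
qed

lemma braket_self_eq_0_iff: "braket x x = 0 \<longleftrightarrow> x = 0"
  by (simp add: braket_self)

text \<open>The adjoint relation: expand both sides and swap the two finite sums. It carries
  complete positivity, invariance under unitaries and the conjugation of projectors below.\<close>

lemma braket_matrix_vector: "braket x (A *v y) = braket (dagger A *v x) y"
proof -
  have "braket x (A *v y) = (\<Sum>i\<in>UNIV. \<Sum>j\<in>UNIV. cnj (x $ i) * (A $ i $ j * y $ j))"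
    by (simp add: braket_def matrix_vector_mult_def sum_distrib_left)
  also have "\<dots> = (\<Sum>j\<in>UNIV. \<Sum>i\<in>UNIV. cnj (x $ i) * (A $ i $ j * y $ j))"
    by (rule sum.swap)
  also have "\<dots> = braket (dagger A *v x) y"
    by (simp add: braket_def dagger_def matrix_vector_mult_def sum_distrib_left mult_ac)
  finally show ?thesis .
qed

lemma dagger_dagger: "dagger (dagger A) = A"
  by (simp add: dagger_def vec_eq_iff)

lemma dagger_mult: "dagger (A ** B) = dagger B ** dagger A"
  by (simp add: dagger_def matrix_matrix_mult_def vec_eq_iff mult.commute)

section \<open>Unitaries, rank-one projectors and unitary channels\<close>

lemma unitary_mult:
  assumes "unitary A" and "unitary B"
  shows "unitary (A ** B)"
proof -
  have "dagger B ** dagger A ** (A ** B) = dagger B ** (dagger A ** A) ** B"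
    "A ** B ** (dagger B ** dagger A) = A ** (B ** dagger B) ** dagger A"
    by (simp_all add: matrix_mul_assoc)
  with assms show ?thesis
    by (simp add: unitary_def dagger_mult)
qed

lemma unitary_dagger: "unitary A \<Longrightarrow> unitary (dagger A)"
  by (simp add: unitary_def dagger_dagger)

lemma braket_unitary: "unitary A \<Longrightarrow> braket (A *v x) (A *v y) = braket x y"
  by (simp add: braket_matrix_vector matrix_vector_mul_assoc unitary_def)

lemma trace_mult_commute: "trace (A ** B) = trace (B ** A)"
  for A B :: "complex^'d^'d"
  by (subst trace_mul_sym) simp

lemma projector_mult_vector: "projector x *v y = braket x y *s x"
  by (simp add: projector_def braket_def matrix_vector_mult_def vec_eq_iff sum_distrib_left
      mult_ac)

lemma trace_projector: "trace (projector x) = braket x x"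
  by (simp add: projector_def braket_def trace_def mult.commute)

text \<open>Conjugation sends pure states to pure states, so the outputs of the channels constructed
  below can be handled as vectors. The two matrices are compared by their action on an arbitrary
  vector.\<close>

lemma conjugate_projector: "A ** projector x ** dagger A = projector (A *v x)"
  by (simp add: matrix_eq projector_mult_vector braket_matrix_vector dagger_dagger
      vector_scalar_commute flip: matrix_vector_mul_assoc)

text \<open>Moving \<open>V\<close> across the inner product turns the block form of the output at
  the vectors \<open>v i\<close> into that of the input at \<open>dagger V *v v i\<close>; this
  gives complete positivity. The trace is preserved because it is cyclic and
  \<open>dagger V ** V = mat 1\<close>.\<close>

lemma quantum_channel_unitary_conjugation:
  assumes "unitary V"
  shows "quantum_channel (\<lambda>X. V ** X ** dagger V)"
  unfolding quantum_channel_def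
proof (intro conjI allI)
  show "Vector_Spaces.linear matrix_scale matrix_scale (\<lambda>X. V ** X ** dagger V)"
    unfolding Vector_Spaces.linear_iff
    by (auto simp: vector_space_matrix_scale matrix_scale_def matrix_matrix_mult_def vec_eq_iff
        sum_distrib_left distrib_left distrib_right sum.distrib mult_ac)
  show "completely_positive (\<lambda>X. V ** X ** dagger V)"
    unfolding completely_positive_def block_positive_def
  proof (intro allI impI)
    fix k and X :: "nat \<Rightarrow> nat \<Rightarrow> complex^'a^'a" and v
    assume "\<forall>v. (\<Sum>i<k. \<Sum>j<k. braket (v i) (X i j *v v j)) \<in> \<real>\<^sub>\<ge>\<^sub>0"
    then have "(\<Sum>i<k. \<Sum>j<k. braket (dagger V *v v i) (X i j *v (dagger V *v v j))) \<in> \<real>\<^sub>\<ge>\<^sub>0"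
      by (rule spec[where x = "\<lambda>i. dagger V *v v i"])
    then show "(\<Sum>i<k. \<Sum>j<k. braket (v i) (V ** X i j ** dagger V *v v j)) \<in> \<real>\<^sub>\<ge>\<^sub>0"
      by (simp add: braket_matrix_vector[of _ V] flip: matrix_vector_mul_assoc)
  qed
  show "trace (V ** X ** dagger V) = trace X" for X
    using assms
    by (simp add: trace_mult_commute[of "V ** X"] matrix_mul_assoc unitary_def)
qed

section \<open>Supports and the upper bound\<close>

lemma support_nonzero:
  assumes "A \<noteq> 0"
  obtains x where "x \<in> support A" and "x \<noteq> 0"
proof -
  obtain i j where ij: "A $ i $ j \<noteq> 0"
    using assms by (auto simp: vec_eq_iff)
  \<comment> \<open>The conjugate of any row of \<open>A\<close> is orthogonal to the kernel of
    \<open>A\<close>; row \<open>i\<close> has a nonzero entry.\<close>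
  define x where "x = (\<chi> j. cnj (A $ i $ j))"
  have "braket y x = cnj ((A *v y) $ i)" for y
    by (simp add: x_def braket_def matrix_vector_mult_def mult.commute)
  then have "x \<in> support A"
    by (simp add: support_def)
  moreover have "x \<noteq> 0"
    using ij by (auto simp: x_def vec_eq_iff)
  ultimately show thesis
    by (rule that)
qed

text \<open>The component \<open>?z\<close> of \<open>x\<close> orthogonal to \<open>a\<close> lies
  in the kernel of the projector, so \<open>x\<close> is orthogonal to it. As \<open>a\<close> is
  too, \<open>?z\<close> is orthogonal to itself and vanishes.\<close>

lemma support_projectorD:
  assumes "x \<in> support (projector a)" and "braket a a = 1"
  shows "x = braket a x *s a"
proof -
  let ?z = "x - braket a x *s a"
  have az: "braket a ?z = 0"
    using assms(2) by (simp add: braket_diff_right braket_scale_right)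
  then have "braket ?z x = 0"
    using assms(1) by (simp add: support_def projector_mult_vector)
  moreover have "braket ?z a = 0"
    using az by (metis cnj_braket complex_cnj_zero)
  ultimately have "braket ?z ?z = 0"
    by (simp add: braket_diff_right[of ?z] braket_scale_right)
  then show ?thesis
    by (simp add: braket_self_eq_0_iff)
qed

lemma orthogonal_supports_projector:
  assumes "braket a a = 1" and "braket c c = 1" and "braket a c = 0"
  shows "orthogonal_supports (projector a) (projector c)"
  unfolding orthogonal_supports_def
proof (intro ballI)
  fix x y assume "x \<in> support (projector a)" and "y \<in> support (projector c)"
  then have "x = braket a x *s a" "y = braket c y *s c"
    using assms by (auto dest: support_projectorD)
  then have "braket x y = braket (braket a x *s a) (braket c y *s c)"
    by simp
  also have "\<dots> = 0"
    using assms(3) by (simp add: braket_scale_left braket_scale_right)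
  finally show "braket x y = 0" .
qed

text \<open>Pairwise orthogonal nonzero vectors are linearly independent. Since the family is
  indexed, injectivity comes first: two indices with the same vector would make that vector
  orthogonal to itself.\<close>

lemma card_orthogonal_family_le:
  fixes x :: "'a \<Rightarrow> complex^'d"
  assumes "finite S" and nonzero: "\<And>s. s \<in> S \<Longrightarrow> x s \<noteq> 0"
    and orth: "pairwise (\<lambda>s t. braket (x s) (x t) = 0) S"
  shows "card S \<le> CARD('d)"
proof -
  have inj: "inj_on x S"
  proof (rule inj_onI, rule ccontr)
    fix s t assume st: "s \<in> S" "t \<in> S" "x s = x t" "s \<noteq> t"
    then have "braket (x s) (x t) = 0"
      using pairwiseD[OF orth] by blast
    then show False
      using st nonzero[of t] by (simp add: braket_self_eq_0_iff)
  qed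
  have "vec.independent (x ` S)"
  proof (rule vec.independent_if_scalars_zero)
    show "finite (x ` S)"
      using assms(1) by simp
    fix f v assume sum0: "(\<Sum>w\<in>x ` S. f w *s w) = 0" and "v \<in> x ` S"
    then obtain s where s: "s \<in> S" "v = x s"
      by auto
    have "0 = braket (x s) (\<Sum>t\<in>S. f (x t) *s x t)"
      using sum0 by (simp add: sum.reindex[OF inj] braket_def)
    also have "\<dots> = (\<Sum>t\<in>S. if t = s then f (x s) * braket (x s) (x s) else 0)"
      unfolding braket_sum_right braket_scale_right
      using orth s(1) by (intro sum.cong refl) (auto simp: pairwise_def)
    also have "\<dots> = f v * braket v v"
      using assms(1) s by simp
    finally show "f v = 0"
      using nonzero s by (simp add: braket_self_eq_0_iff)
  qed
  then have "card (x ` S) \<le> CARD('d)"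
    using vec.independent_card_le_dim[OF subset_UNIV] unfolding vec_dim_card by blast
  then show ?thesis
    by (simp add: card_image[OF inj])
qed

lemma card_distinguishable_le:
  fixes S :: "(complex^'d^'d \<Rightarrow> complex^'d^'d) set"
  assumes "finite S" and "\<And>\<Phi>. \<Phi> \<in> S \<Longrightarrow> quantum_channel \<Phi>"
    and "perfectly_distinguishable_unentangled S"
  shows "card S \<le> CARD('d)"
proof -
  obtain \<psi> :: "complex^'d" where \<psi>: "norm \<psi> = 1"
    and orth: "pairwise (\<lambda>\<Phi> \<Psi>. orthogonal_supports (\<Phi> (projector \<psi>)) (\<Psi> (projector \<psi>))) S"
    using assms(3) by (auto simp: perfectly_distinguishable_unentangled_def)
  have "\<exists>x. x \<in> support (\<Phi> (projector \<psi>)) \<and> x \<noteq> 0" if "\<Phi> \<in> S" for \<Phi>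
  proof -
    have "trace (\<Phi> (projector \<psi>)) = 1"
      using assms(2)[OF that] \<psi> by (simp add: quantum_channel_def trace_projector braket_self)
    then have "\<Phi> (projector \<psi>) \<noteq> 0"
      by (auto simp: trace_def)
    then show ?thesis
      using support_nonzero by metis
  qed
  then obtain x where x: "\<And>\<Phi>. \<Phi> \<in> S \<Longrightarrow> x \<Phi> \<in> support (\<Phi> (projector \<psi>)) \<and> x \<Phi> \<noteq> 0"
    by metis
  show ?thesis
  proof (rule card_orthogonal_family_le[where x = x])
    show "pairwise (\<lambda>\<Phi> \<Psi>. braket (x \<Phi>) (x \<Psi>) = 0) S"
      using orth x by (auto simp: pairwise_def orthogonal_supports_def)
  qed (use assms(1) x in auto)
qed

section \<open>Fourier phases and the lower bound\<close>

lemma fourier_phases: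
  obtains p :: "'d::finite \<Rightarrow> 'd \<Rightarrow> complex" where "\<And>n k. cmod (p n k) = 1"
    and "\<And>m n. m \<noteq> n \<Longrightarrow> (\<Sum>k\<in>UNIV. cnj (p m k) * p n k) = 0"
proof -
  let ?d = "CARD('d)"
  have d: "?d > 0"
    by simp
  \<comment> \<open>The index type carries no order or arithmetic, so \<open>f\<close> numbers its
    elements from 0 for use as exponents, while \<open>w\<close> below labels the roots of unity of
    order dividing \<open>?d\<close> by the same type.\<close>
  obtain f :: "'d \<Rightarrow> nat" where f: "bij_betw f UNIV {..<?d}"
    using finite_same_card_bij[of "UNIV :: 'd set" "{..<?d}"] by auto
  have "card {z::complex. z ^ ?d = 1} = ?d"
    using d by (rule card_roots_unity_eq)
  then obtain w :: "'d \<Rightarrow> complex" where w: "bij_betw w UNIV {z. z ^ ?d = 1}"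
    using finite_same_card_bij[of "UNIV :: 'd set" "{z::complex. z ^ ?d = 1}"]
      finite_roots_unity[of ?d, where 'a = complex] by auto
  have root: "w n ^ ?d = 1" for n
    using w by (auto simp: bij_betw_def)
  have norm_w: "cmod (w n) = 1" for n
  proof -
    have "cmod (w n) ^ ?d = 1"
      by (metis norm_one norm_power root)
    then show ?thesis
      using d power_eq_1_iff by fastforce
  qed
  show thesis
  \<comment> \<open>Up to labelling and normalisation this is the Fourier matrix; orthogonality of
    two rows is a vanishing geometric sum.\<close>
  proof (rule that[of "\<lambda>n k. w n ^ f k"])
    show "cmod (w n ^ f k) = 1" for n k
      by (simp add: norm_power norm_w)
    fix m n :: 'd assume "m \<noteq> n"
    then have "w m \<noteq> w n"
      using w by (auto simp: bij_betw_def inj_on_def)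
    \<comment> \<open>As \<open>w m\<close> has modulus 1, \<open>z\<close> is the quotient
      \<open>w n / w m\<close>, a root of unity other than 1.\<close>
    define z where "z = cnj (w m) * w n"
    have "w m * z = w n"
      using norm_w[of m] complex_norm_square[of "w m"] by (simp add: z_def flip: mult.assoc)
    then have "z \<noteq> 1"
      using \<open>w m \<noteq> w n\<close> by auto
    have "z ^ ?d = 1"
      by (simp add: z_def power_mult_distrib root flip: complex_cnj_power)
    have "(\<Sum>k\<in>UNIV. cnj (w m ^ f k) * w n ^ f k) = (\<Sum>k\<in>UNIV. z ^ f k)"
      by (simp add: z_def power_mult_distrib)
    also have "\<dots> = (\<Sum>k<?d. z ^ k)"
      by (rule sum.reindex_bij_betw[OF f])
    also have "\<dots> = 0"
      using \<open>z \<noteq> 1\<close> \<open>z ^ ?d = 1\<close> by (simp add: geometric_sum)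
    finally show "(\<Sum>k\<in>UNIV. cnj (w m ^ f k) * w n ^ f k) = 0" .
  qed
qed

lemma cnj_mult_self_of_norm_1: "cmod z = 1 \<Longrightarrow> cnj z * z = 1"
  using complex_norm_square[of z] by (simp add: mult.commute)

lemma unitary_if_left_inverse: "dagger A ** A = mat 1 \<Longrightarrow> unitary A"
  using matrix_left_right_inverse unitary_def by blast

lemma unitary_diagonal:
  assumes "\<And>k. cmod (p k) = 1"
  shows "unitary (\<chi> i j. if i = j then p i else 0)" (is "unitary ?D")
proof (rule unitary_if_left_inverse)
  have "(dagger ?D ** ?D) $ i $ j = (\<Sum>k\<in>UNIV. if k = i then if i = j then 1 else 0 else 0)" for i j
    unfolding matrix_matrix_mult_def dagger_def vec_lambda_beta
    using cnj_mult_self_of_norm_1[OF assms] by (intro sum.cong refl) simp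
  then show "dagger ?D ** ?D = mat 1"
    by (simp add: vec_eq_iff mat_def)
qed

lemma unitary_of_orthonormal_basis:
  assumes "orthonormal_basis b"
  shows "unitary (\<chi> i j. b j $ i)"
  using assms
  by (intro unitary_if_left_inverse)
    (simp add: orthonormal_basis_def braket_def dagger_def matrix_matrix_mult_def mat_def
      vec_eq_iff)

lemma distinguishable_family_exists:
  fixes b :: "'d::finite \<Rightarrow> complex^'d" and T :: "real^'d^'d"
  assumes b: "orthonormal_basis b" and "unistochastic T"
  obtains S where "finite S" and "card S = CARD('d)"
    and "\<And>\<Phi>. \<Phi> \<in> S \<Longrightarrow> quantum_channel \<Phi> \<and> has_classical_action b \<Phi> T"
    and "perfectly_distinguishable_unentangled S"
proof -
  obtain U where U: "unitary U" and T: "\<And>k l. T $ k $ l = (cmod (U $ k $ l))\<^sup>2"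
    using assms(2) by (auto simp: unistochastic_def)
  obtain p :: "'d \<Rightarrow> 'd \<Rightarrow> complex" where norm_p: "\<And>n k. cmod (p n k) = 1"
    and orth_p: "\<And>m n. m \<noteq> n \<Longrightarrow> (\<Sum>k\<in>UNIV. cnj (p m k) * p n k) = 0"
    by (rule fourier_phases) blast
  \<comment> \<open>\<open>B\<close> turns coordinates into vectors with respect to
    \<open>b\<close>, so \<open>V n\<close> is the operator with matrix \<open>U ** D n\<close> in
    that basis, and \<psi> is the normalised uniform superposition of the basis vectors.\<close>
  define B where "B = (\<chi> i j. b j $ i)"
  define D where "D n = (\<chi> i j. if i = j then p n i else 0)" for n
  define V where "V n = B ** U ** D n ** dagger B" for n
  define \<Phi> where "\<Phi> n = (\<lambda>X. V n ** X ** dagger (V n))" for n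
  define u :: "complex^'d" where "u = (\<chi> k. of_real (1 / sqrt CARD('d)))"
  define \<psi> where "\<psi> = B *v u"
  have B: "unitary B"
    using unitary_of_orthonormal_basis[OF b] by (simp add: B_def)
  have V: "unitary (V n)" for n
    unfolding V_def D_def by (intro unitary_mult unitary_dagger unitary_diagonal norm_p B U)
  have B_axis: "B *v axis l 1 = b l" for l
    by (simp add: B_def axis_def matrix_vector_mult_def vec_eq_iff if_distrib cong: if_cong)
  have V_B: "V n *v (B *v x) = B *v (U *v (D n *v x))" for n x
    using B by (simp add: V_def unitary_def matrix_vector_mul_assoc flip: matrix_mul_assoc)
  have D_nth: "(D n *v x) $ k = p n k * x $ k" for n x k
    by (simp add: D_def matrix_vector_mult_def if_distrib if_distribR cong: if_cong)

  \<comment> \<open>The diagonal factor multiplies column \<open>l\<close> of \<open>U\<close> by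
    the phase \<open>p n l\<close>, which disappears on taking squared moduli.\<close>
  have amplitude: "braket (b k) (V n *v b l) = U $ k $ l * p n l" for n k l
  proof -
    have "D n *v axis l 1 = p n l *s axis l 1"
      by (auto simp: vec_eq_iff D_nth axis_def)
    then have "V n *v b l = B *v (p n l *s (U *v axis l 1))"
      by (metis B_axis V_B vector_scalar_commute)
    then have "braket (b k) (V n *v b l) = braket (axis k 1) (p n l *s (U *v axis l 1))"
      using braket_unitary[OF B] by (metis B_axis)
    also have "\<dots> = U $ k $ l * p n l"
      by (simp add: braket_def axis_def matrix_vector_mult_def if_distrib if_distribR mult.commute
          cong: if_cong)
    finally show ?thesis .
  qed
  have action: "has_classical_action b (\<Phi> n) T" for n
    unfolding has_classical_action_def
  proof (intro allI)
    fix k l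
    let ?a = "braket (b k) (V n *v b l)"
    have "braket (b k) (\<Phi> n (projector (b l)) *v b k) = cnj ?a * ?a"
      by (simp add: \<Phi>_def conjugate_projector projector_mult_vector braket_scale_right cnj_braket)
    also have "\<dots> = of_real ((cmod ?a)\<^sup>2)"
      by (metis complex_norm_square mult.commute of_real_power)
    finally show "complex_of_real (T $ k $ l) = braket (b k) (\<Phi> n (projector (b l)) *v b k)"
      by (simp add: amplitude T norm_mult norm_p)
  qed

  have "braket u u = 1"
    by (simp add: u_def braket_def flip: of_real_mult)
  then have psi: "braket \<psi> \<psi> = 1"
    by (simp add: \<psi>_def braket_unitary[OF B])
  then have "(norm \<psi>)\<^sup>2 = 1"
    by (metis braket_self of_real_eq_1_iff)
  then have norm_psi: "norm \<psi> = 1"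
    using norm_ge_zero[of \<psi>] unfolding power2_eq_1_iff by linarith
  have image: "\<Phi> n (projector \<psi>) = projector (V n *v \<psi>)" for n
    by (simp add: \<Phi>_def conjugate_projector)
  have unit: "braket (V n *v \<psi>) (V n *v \<psi>) = 1" for n
    using psi by (simp add: braket_unitary[OF V])
  have orth: "braket (V m *v \<psi>) (V n *v \<psi>) = 0" if "m \<noteq> n" for m n
  proof -
    \<comment> \<open>The common isometries \<open>B\<close> and \<open>U\<close> cancel, leaving
      the inner product of two rows of phases scaled by the constant entry of
      \<open>u\<close>.\<close>
    have "braket (V m *v \<psi>) (V n *v \<psi>) = braket (D m *v u) (D n *v u)"
      by (simp add: \<psi>_def V_B braket_unitary[OF B] braket_unitary[OF U])
    also have "\<dots> = (\<Sum>k\<in>UNIV. cnj (p m k) * p n k) * (of_real (1 / sqrt CARD('d)))\<^sup>2"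
      unfolding sum_distrib_right
      by (simp add: braket_def D_nth u_def power2_eq_square algebra_simps)
    finally show ?thesis
      using orth_p[OF that] by simp
  qed
  \<comment> \<open>Distinct labels must give distinct channels for the range to have full
    cardinality. If two coincided, their common output projector would both annihilate and fix the
    unit vector \<open>V n *v\<close> \<psi>.\<close>
  have inj: "inj \<Phi>"
  proof (rule injI, rule ccontr)
    fix m n assume eq: "\<Phi> m = \<Phi> n" and "m \<noteq> n"
    have "projector (V m *v \<psi>) *v (V n *v \<psi>) = projector (V n *v \<psi>) *v (V n *v \<psi>)"
      by (metis eq image)
    then have "V n *v \<psi> = 0"
      using unit orth[OF \<open>m \<noteq> n\<close>] by (simp add: projector_mult_vector)
    then show False
      using unit[of n] by (simp add: braket_def)
  qed
  show thesis
  proof (rule that[of "range \<Phi>"])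
    show "card (range \<Phi>) = CARD('d)"
      by (rule card_image[OF inj])
    show "quantum_channel \<Psi> \<and> has_classical_action b \<Psi> T" if "\<Psi> \<in> range \<Phi>" for \<Psi>
      using that action quantum_channel_unitary_conjugation[OF V] by (auto simp: \<Phi>_def)
    have "orthogonal_supports (\<Phi> m (projector \<psi>)) (\<Phi> n (projector \<psi>))" if "m \<noteq> n" for m n
      unfolding image by (intro orthogonal_supports_projector unit orth that)
    then show "perfectly_distinguishable_unentangled (range \<Phi>)"
      unfolding perfectly_distinguishable_unentangled_def
      by (intro exI[of _ \<psi>] conjI norm_psi) (auto simp: pairwise_def, metis)
  qed simp
qed

theorem proposition15:
  fixes b :: "'d::finite \<Rightarrow> complex^'d" and T :: "real^'d^'d"
  assumes "orthonormal_basis b" and "unistochastic T"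
  shows "restricted_distinguishability b T = enat CARD('d)"
proof (rule antisym)
  show "restricted_distinguishability b T \<le> enat CARD('d)"
    unfolding restricted_distinguishability_def
    by (rule Sup_least) (use card_distinguishable_le in force)
  obtain S where "finite S" "card S = CARD('d)"
    "\<And>\<Phi>. \<Phi> \<in> S \<Longrightarrow> quantum_channel \<Phi> \<and> has_classical_action b \<Phi> T"
    "perfectly_distinguishable_unentangled S"
    using distinguishable_family_exists[OF assms] by metis
  then show "enat CARD('d) \<le> restricted_distinguishability b T"
    unfolding restricted_distinguishability_def
    by (intro Sup_upper) (auto intro!: exI[of _ S])
qed

end
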